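(* Let $h\colon U\to U$ be a diffeomorphism and let $\Psi(u,u^\ast)=\big(h(u),\,u^\ast\circ(\mathrm Dh(u))^{-1}\big)$ on $V=U\oplus U^\ast$. Suppose $\Psi$ is an ordinary symmetry for every map of a family $(\phi_\mu)_\mu$ of symplectic maps with generating functions $S_\mu$, and suppose a family of separated Lagrangian boundary conditions $v\in G_\mu$, $\phi_\mu(v)\in\underline G_\mu$, with generating functions $B_\mu(u,\underline u)=b_\mu(u)-\underline b_\mu(\underline u)$, is given which is invariant under $\Psi$, i.e. $\Psi(G_\mu)=G_\mu$ and $\Psi(\underline G_\mu)=\underline G_\mu$. Then the Lagrangian boundary value problem behaves like the gradient-zero problem $\nabla\tilde S_\mu(u,\underline u)=0$ with symmetry $\tilde S_\mu\circ(h\times h)=\tilde S_\mu$ (up to a constant), where $\tilde S_\mu=S_\mu-B_\mu$; that is, solutions of the boundary value problem correspond to the critical points $(u,\underline u)$ of $\tilde S_\mu$, and $\tilde S_\mu$ has the stated symmetry.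
   Context: $U$ is a finite-dimensional real vector space, $V=U\oplus U^\ast$ carries the symplectic form $\omega((u,u^\ast),(v,v^\ast))=u^\ast(v)-v^\ast(u)$, and $\underline V=\underline U\oplus\underline U^\ast$ is a copy of $(V,\omega)$, identified with $V$ where needed. Each $\phi_\mu\colon V\to\underline V$ is a symplectic map with generating function $S_\mu\colon U\oplus\underline U\to\mathbb R$, i.e. $$\{(v,\phi_\mu(v)): v\in V\}=\{(u,\mathrm D_uS_\mu(u,\underline u),\underline u,-\mathrm D_{\underline u}S_\mu(u,\underline u)):(u,\underline u)\in U\oplus\underline U\} .$$ The boundary conditions are given by $G_\mu=\{(u,\mathrm Db_\mu(u)):u\in U\}$ and $\underline G_\mu=\{(\underline u,\mathrm D\underline b_\mu(\underline u)):\underline u\in\underline U\}$ for smooth $b_\mu\colon U\to\mathbb R$, $\underline b_\mu\colon\underline U\to\mathbb R$. $(h\times h)(u,\underline u)=(h(u),h(\underline u))$. All maps are local (defined on neighbourhoods of $0$, shrunk if necessary; this is suppressed in the notation). $\Psi$ (which is symplectic) is an ordinary symmetry for $\phi_\mu$ if $\Psi^{-1}\circ\phi_\mu\circ\Psi=\phi_\mu$. *)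

theory Defs
  imports "HOL-Analysis.Analysis"
begin

text \<open>
  All maps are local: they are total HOL functions together with an explicit open set on which
  they are regarded as defined. Taking every such set to be \<^term>\<open>UNIV\<close> gives the global setting;
  taking neighbourhoods of the origin gives the setting of local maps. The copy of
  \<open>U\<close> (and of \<open>V\<close>) in the codomain is represented by the same type.
\<close>

type_synonym 'a dual = "'a \<Rightarrow>\<^sub>L real"
type_synonym 'a phase = "'a \<times> 'a dual"


subsection \<open>Smooth maps\<close>

text \<open>
  \<open>C\<^sup>k\<close> via iterated directional derivatives, which avoids a recursion through the types of
  higher derivatives. On an open subset of a finite-dimensional space (the only use below) this is
  the usual notion.
\<close>

fun Ck_on :: "nat \<Rightarrow> ('a::real_normed_vector \<Rightarrow> 'b::real_normed_vector) \<Rightarrow> 'a set \<Rightarrow> bool" where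
  "Ck_on 0 f X \<longleftrightarrow> continuous_on X f"
| "Ck_on (Suc k) f X \<longleftrightarrow>
     (\<forall>x\<in>X. f differentiable (at x)) \<and>
     (\<forall>v. Ck_on k (\<lambda>x. frechet_derivative f (at x) v) X)"

definition smooth_on :: "('a::real_normed_vector \<Rightarrow> 'b::real_normed_vector) \<Rightarrow> 'a set \<Rightarrow> bool" where
  "smooth_on f X \<longleftrightarrow> (\<forall>k. Ck_on k f X)"

definition diffeo_on :: "'a set \<Rightarrow> ('a::real_normed_vector \<Rightarrow> 'b::real_normed_vector) \<Rightarrow> bool" where
  "diffeo_on N h \<longleftrightarrow>
     open N \<and> open (h ` N) \<and> inj_on h N \<and> smooth_on h N \<and> smooth_on (inv_into N h) (h ` N)"

definition deriv_at :: "('a::real_normed_vector \<Rightarrow> 'b::real_normed_vector) \<Rightarrow> 'a \<Rightarrow> 'a \<Rightarrow>\<^sub>L 'b" where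
  "deriv_at f x = Blinfun (frechet_derivative f (at x))"

definition partial1 :: "('a::euclidean_space \<times> 'a \<Rightarrow> real) \<Rightarrow> 'a \<Rightarrow> 'a \<Rightarrow> 'a dual" where
  "partial1 S u w = deriv_at (\<lambda>x. S (x, w)) u"

definition partial2 :: "('a::euclidean_space \<times> 'a \<Rightarrow> real) \<Rightarrow> 'a \<Rightarrow> 'a \<Rightarrow> 'a dual" where
  "partial2 S u w = deriv_at (\<lambda>y. S (u, y)) w"


subsection \<open>Symplectic maps and generating functions\<close>

definition omega :: "'a::euclidean_space phase \<Rightarrow> 'a phase \<Rightarrow> real" where
  "omega x y = blinfun_apply (snd x) (fst y) - blinfun_apply (snd y) (fst x)"

definition symplectic_on :: "'a::euclidean_space phase set \<Rightarrow> ('a phase \<Rightarrow> 'a phase) \<Rightarrow> bool" where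
  "symplectic_on D \<phi> \<longleftrightarrow>
     open D \<and> smooth_on \<phi> D \<and>
     (\<forall>v\<in>D. \<forall>x y. omega (frechet_derivative \<phi> (at v) x) (frechet_derivative \<phi> (at v) y)
                    = omega x y)"

definition generating_function_on ::
  "('a::euclidean_space \<times> 'a) set \<Rightarrow> ('a \<times> 'a \<Rightarrow> real) \<Rightarrow> 'a phase set \<Rightarrow> ('a phase \<Rightarrow> 'a phase) \<Rightarrow> bool"
  where
  "generating_function_on W S D \<phi> \<longleftrightarrow>
     open W \<and> smooth_on S W \<and>
     {(v, \<phi> v) | v. v \<in> D} = {((u, partial1 S u w), (w, - partial2 S u w)) | u w. (u, w) \<in> W}"


subsection \<open>Symmetries\<close>

definition cotangent_lift :: "('a::euclidean_space \<Rightarrow> 'a) \<Rightarrow> 'a phase \<Rightarrow> 'a phase" where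
  "cotangent_lift h p =
     (h (fst p), snd p o\<^sub>L Blinfun (inv (blinfun_apply (deriv_at h (fst p)))))"

text \<open>The natural domain of \<open>\<Psi>\<^sup>-\<^sup>1 \<circ> \<phi> \<circ> \<Psi>\<close> for \<open>\<Psi>\<close> defined on \<open>P\<close> and \<open>\<phi>\<close> defined on \<open>D\<close>.\<close>

definition conj_domain :: "'v set \<Rightarrow> ('v \<Rightarrow> 'v) \<Rightarrow> 'v set \<Rightarrow> ('v \<Rightarrow> 'v) \<Rightarrow> 'v set" where
  "conj_domain P \<Psi> D \<phi> = {v \<in> P. \<Psi> v \<in> D \<and> \<phi> (\<Psi> v) \<in> \<Psi> ` P}"

definition ordinary_symmetry_on :: "'v set \<Rightarrow> ('v \<Rightarrow> 'v) \<Rightarrow> 'v set \<Rightarrow> ('v \<Rightarrow> 'v) \<Rightarrow> bool" where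
  "ordinary_symmetry_on P \<Psi> D \<phi> \<longleftrightarrow>
     (\<forall>v \<in> D \<inter> conj_domain P \<Psi> D \<phi>. inv_into P \<Psi> (\<phi> (\<Psi> v)) = \<phi> v)"


subsection \<open>Separated Lagrangian boundary conditions\<close>

definition deriv_graph :: "'a::euclidean_space set \<Rightarrow> ('a \<Rightarrow> real) \<Rightarrow> 'a phase set" where
  "deriv_graph A b = {(u, deriv_at b u) | u. u \<in> A}"

text \<open>
  \<open>\<Psi>(G) = G\<close> for the lift \<open>\<Psi>\<close> of a map \<open>h\<close> defined on \<open>N\<close> and \<open>G = deriv_graph A b\<close>, read over the
  base points where both sides are defined: the part of \<open>G\<close> over \<open>A \<inter> N \<inter> h -` A\<close> is mapped onto the
  part of \<open>G\<close> over \<open>h ` (A \<inter> N) \<inter> A\<close>. If \<open>A = N = h ` N\<close> (in particular if all of them are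
  \<^term>\<open>UNIV\<close>), this is literally \<open>\<Psi> ` G = G\<close>.
\<close>

definition invariant_graph ::
  "'a::euclidean_space set \<Rightarrow> ('a \<Rightarrow> 'a) \<Rightarrow> 'a set \<Rightarrow> ('a \<Rightarrow> real) \<Rightarrow> bool" where
  "invariant_graph N h A b \<longleftrightarrow>
     cotangent_lift h ` deriv_graph (A \<inter> N \<inter> h -` A) b = deriv_graph (h ` (A \<inter> N) \<inter> A) b"

definition bvp_solutions ::
  "'a phase set \<Rightarrow> ('a phase \<Rightarrow> 'a phase) \<Rightarrow> 'a::euclidean_space phase set \<Rightarrow> 'a phase set \<Rightarrow> 'a phase set"
  where
  "bvp_solutions D \<phi> G G' = {v \<in> D. v \<in> G \<and> \<phi> v \<in> G'}"

definition critical_points ::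
  "('a::euclidean_space \<times> 'a) set \<Rightarrow> ('a \<times> 'a \<Rightarrow> real) \<Rightarrow> ('a \<times> 'a) set" where
  "critical_points W F = {p \<in> W. GDERIV F p :> 0}"

text \<open>
  The pairs \<open>(u, w)\<close> in \<open>W\<close> for which the corresponding initial value
  \<open>v = (u, D\<^sub>u S (u, w))\<close> lies in the domain of \<open>\<Psi>\<^sup>-\<^sup>1 \<circ> \<phi> \<circ> \<Psi>\<close>; for globally defined
  data with \<open>h\<close> bijective this is everything.
\<close>

definition symmetry_domain ::
  "'a::euclidean_space set \<Rightarrow> ('a \<Rightarrow> 'a) \<Rightarrow> ('a \<times> 'a) set \<Rightarrow> ('a \<times> 'a \<Rightarrow> real) \<Rightarrow>
   'a phase set \<Rightarrow> ('a phase \<Rightarrow> 'a phase) \<Rightarrow> ('a \<times> 'a) set" where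
  "symmetry_domain N h W S D \<phi> =
     {(u, w) \<in> W. (u, partial1 S u w) \<in> conj_domain (N \<times> UNIV) (cotangent_lift h) D \<phi>}"

end

theory Submission
  imports Defs
begin

text \<open>
  If \<open>v = (u, D\<^sub>u S)\<close> and \<open>\<phi> v = (w, - D\<^sub>w S)\<close>, then \<open>\<phi> \<circ> \<Psi> = \<Psi> \<circ> \<phi>\<close> says that
  the graph of \<open>\<phi>\<close> contains \<open>(\<Psi> v, \<Psi> (\<phi> v))\<close>, a point over \<open>(h u, h w)\<close>. Hence the partial
  derivatives of \<open>S\<close> at \<open>(h u, h w)\<close>, pulled back along \<open>Dh\<close>, are those at \<open>(u, w)\<close>, and the
  invariance of the boundary graphs gives the same for \<open>b\<close> and \<open>b'\<close>. So \<open>S' \<circ> (h \<times> h) - S'\<close> has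
  derivative zero.
\<close>

section \<open>Smooth maps, total derivatives and partial derivatives\<close>

lemma smooth_on_differentiable:
  "smooth_on f X \<Longrightarrow> x \<in> X \<Longrightarrow> f differentiable (at x)"
  unfolding smooth_on_def by (metis Ck_on.simps(2))

lemma smooth_on_continuous_on: "smooth_on f X \<Longrightarrow> continuous_on X f"
  unfolding smooth_on_def by (metis Ck_on.simps(1))

lemma has_derivative_deriv_at:
  "f differentiable (at x) \<Longrightarrow> (f has_derivative blinfun_apply (deriv_at f x)) (at x)"
  unfolding deriv_at_def
  by (simp add: frechet_derivative_works bounded_linear_Blinfun_apply has_derivative_bounded_linear)

lemma deriv_at_eqI:
  "(f has_derivative blinfun_apply L) (at x) \<Longrightarrow> deriv_at f x = L"
  unfolding deriv_at_def
  by (metis frechet_derivative_at blinfun_apply_inverse)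

text \<open>Smoothness is phrased through directional derivatives, one direction at a time. In
  finite dimension their continuity along basis vectors gives continuity in operator norm, which the
  openness arguments below rely on.\<close>

lemma continuous_on_deriv_at:
  fixes f :: "'a::euclidean_space \<Rightarrow> 'b::real_normed_vector"
  assumes f: "smooth_on f X"
  shows "continuous_on X (deriv_at f)"
proof (rule continuous_on_blinfun_componentwise)
  fix i :: 'a
  have "Ck_on (Suc 0) f X"
    using f by (simp add: smooth_on_def del: Ck_on.simps)
  then have "continuous_on X (\<lambda>x. frechet_derivative f (at x) i)"
    by simp
  \<comment> \<open>\<open>Blinfun\<close> returns the intended map only for bounded linear
    arguments, so differentiability at \<open>x\<close> enters here.\<close>
  moreover have "deriv_at f x i = frechet_derivative f (at x) i" if "x \<in> X" for x
    by (rule fun_cong[OF frechet_derivative_at])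
       (rule has_derivative_deriv_at[OF smooth_on_differentiable[OF f that]])
  ultimately show "continuous_on X (\<lambda>x. deriv_at f x i)"
    by (simp cong: continuous_on_cong)
qed

text \<open>Both claims come from restricting the total derivative to the coordinate subspaces. The
  second form, total derivative after inclusion, lets \<open>partial1\<close> inherit continuity in
  \<open>(u, w)\<close> from \<open>deriv_at S\<close>.\<close>

lemma has_derivative_partials:
  assumes "S differentiable (at (u, w))"
  shows "(S has_derivative (\<lambda>z. partial1 S u w (fst z) + partial2 S u w (snd z))) (at (u, w))"
    and "partial1 S u w = deriv_at S (u, w) o\<^sub>L Blinfun (\<lambda>x. (x, 0))"
proof -
  let ?L = "deriv_at S (u, w)"
  have L: "(S has_derivative ?L) (at (u, w))"
    using assms by (rule has_derivative_deriv_at)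
  have bl: "bounded_linear (\<lambda>x::'a. (x, 0::'a))" "bounded_linear (\<lambda>y::'a. (0::'a, y))"
    by (auto intro!: bounded_linear_intros)
  have "((\<lambda>x. S (x, w)) has_derivative (\<lambda>x. ?L (x, 0))) (at u)"
    by (rule has_derivative_compose[where g = S and f = "\<lambda>x. (x, w)", simplified])
       (auto intro!: derivative_eq_intros L)
  then show 1: "partial1 S u w = ?L o\<^sub>L Blinfun (\<lambda>x. (x, 0))"
    unfolding partial1_def
    by (intro deriv_at_eqI)
      (simp add: bounded_linear_Blinfun_apply[OF bl(1)] blinfun_compose.rep_eq o_def)
  have "((\<lambda>y. S (u, y)) has_derivative (\<lambda>y. ?L (0, y))) (at w)"
    by (rule has_derivative_compose[where g = S and f = "\<lambda>y. (u, y)", simplified])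
       (auto intro!: derivative_eq_intros L)
  then have 2: "partial2 S u w = ?L o\<^sub>L Blinfun (\<lambda>y. (0, y))"
    unfolding partial2_def
    by (intro deriv_at_eqI)
      (simp add: bounded_linear_Blinfun_apply[OF bl(2)] blinfun_compose.rep_eq o_def)
  \<comment> \<open>Linearity of \<open>?L\<close> applied to
    \<open>z = (fst z, 0) + (0, snd z)\<close>.\<close>
  have "partial1 S u w (fst z) + partial2 S u w (snd z) = ?L z" for z
    unfolding 1 2
    by (simp add: bounded_linear_Blinfun_apply[OF bl(1)] bounded_linear_Blinfun_apply[OF bl(2)]
        flip: blinfun.add_right)
  then show "(S has_derivative (\<lambda>z. partial1 S u w (fst z) + partial2 S u w (snd z))) (at (u, w))"
    using L by simp
qed

lemma continuous_on_partial1: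
  assumes "smooth_on S W"
  shows "continuous_on W (\<lambda>(u, w). partial1 S u w)"
proof -
  have "continuous_on W (\<lambda>p. deriv_at S p o\<^sub>L Blinfun (\<lambda>x. (x, 0)))"
    by (intro continuous_intros continuous_on_deriv_at assms)
  then show ?thesis
    using has_derivative_partials(2)[OF smooth_on_differentiable[OF assms]]
    by (auto cong: continuous_on_cong simp: case_prod_unfold)
qed

section \<open>Graphs of derivatives and of maps with a generating function\<close>

lemma mem_deriv_graph_iff: "v \<in> deriv_graph A b \<longleftrightarrow> fst v \<in> A \<and> snd v = deriv_at b (fst v)"
  by (auto simp: deriv_graph_def prod_eq_iff)

lemma generating_function_on_graphD:
  assumes "generating_function_on W S D \<phi>" "v \<in> D"
  shows "(fst v, fst (\<phi> v)) \<in> W"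
    and "snd v = partial1 S (fst v) (fst (\<phi> v))"
    and "snd (\<phi> v) = - partial2 S (fst v) (fst (\<phi> v))"
proof -
  have "(v, \<phi> v) \<in> {((u, partial1 S u w), (w, - partial2 S u w)) | u w. (u, w) \<in> W}"
    using assms unfolding generating_function_on_def by blast
  then show "(fst v, fst (\<phi> v)) \<in> W"
    and "snd v = partial1 S (fst v) (fst (\<phi> v))"
    and "snd (\<phi> v) = - partial2 S (fst v) (fst (\<phi> v))"
    by auto
qed

lemma generating_function_on_graphI:
  assumes "generating_function_on W S D \<phi>" "(u, w) \<in> W"
  shows "(u, partial1 S u w) \<in> D" and "\<phi> (u, partial1 S u w) = (w, - partial2 S u w)"
proof -
  have "((u, partial1 S u w), (w, - partial2 S u w)) \<in> {(v, \<phi> v) | v. v \<in> D}"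
    using assms unfolding generating_function_on_def by blast
  then show "(u, partial1 S u w) \<in> D" and "\<phi> (u, partial1 S u w) = (w, - partial2 S u w)"
    by auto
qed

section \<open>Cotangent lift of a local diffeomorphism\<close>

lemma diffeo_on_deriv_inverse:
  assumes h: "diffeo_on N h" and u: "u \<in> N"
  shows "deriv_at (inv_into N h) (h u) (deriv_at h u x) = x"
    and "deriv_at h u (deriv_at (inv_into N h) (h u) x) = x"
proof -
  let ?g = "inv_into N h"
  have N: "open N" "open (h ` N)" "inj_on h N" "smooth_on h N" "smooth_on ?g (h ` N)"
    using h by (auto simp: diffeo_on_def)
  have dh: "(h has_derivative deriv_at h u) (at u)"
    using has_derivative_deriv_at smooth_on_differentiable N(4) u by blast
  have dg: "(?g has_derivative deriv_at ?g (h u)) (at (h u))"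
    using has_derivative_deriv_at smooth_on_differentiable N(5) u by blast
  \<comment> \<open>Chain rule for \<open>?g \<circ> h\<close>, which is the identity on the open
    set \<open>N\<close>, hence near \<open>u\<close>.\<close>
  have "((\<lambda>x. x) has_derivative (\<lambda>x. deriv_at ?g (h u) (deriv_at h u x))) (at u)"
    by (rule has_derivative_transform_within_open[OF has_derivative_compose[OF dh dg] N(1) u])
       (simp add: N(3))
  then show "deriv_at ?g (h u) (deriv_at h u x) = x"
    using has_derivative_unique[OF _ has_derivative_ident] by metis
  \<comment> \<open>The base point is rewritten so that the chain rule applies to
    \<open>h \<circ> ?g\<close> at \<open>h u\<close>.\<close>
  have "(h has_derivative deriv_at h u) (at (?g (h u)))"
    using dh N(3) u by simp
  then have "((\<lambda>x. x) has_derivative (\<lambda>x. deriv_at h u (deriv_at ?g (h u) x))) (at (h u))"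
    by (intro has_derivative_transform_within_open[OF has_derivative_compose[OF dg] N(2)])
       (auto simp: u f_inv_into_f)
  then show "deriv_at h u (deriv_at ?g (h u) x) = x"
    using has_derivative_unique[OF _ has_derivative_ident] by metis
qed

text \<open>The inverse of the derivative is itself the derivative of the inverse map. It is
  therefore a genuine bounded linear map, so \<open>Blinfun\<close> is harmless, and it varies
  continuously with the base point.\<close>

lemma cotangent_lift_diffeo:
  assumes h: "diffeo_on N h" and u: "u \<in> N"
  shows "cotangent_lift h (u, p) = (h u, p o\<^sub>L deriv_at (inv_into N h) (h u))"
proof -
  have "inv (deriv_at h u) = deriv_at (inv_into N h) (h u)"
    by (intro inv_equality diffeo_on_deriv_inverse assms)
  then show ?thesis
    by (simp add: cotangent_lift_def blinfun_apply_inverse)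
qed

text \<open>Moves the inverse of \<open>Dh\<close> to the other side: equality with a lifted
  covector becomes a pullback along \<open>Dh\<close>, the shape that the chain rule
  produces.\<close>

lemma cotangent_lift_diffeo_pullback:
  assumes "diffeo_on N h" "u \<in> N" "cotangent_lift h (u, p) = (h u, q)"
  shows "q (deriv_at h u x) = p x"
  using assms by (auto simp: cotangent_lift_diffeo diffeo_on_deriv_inverse)

lemma continuous_on_cotangent_lift:
  assumes h: "diffeo_on N h"
  shows "continuous_on (N \<times> UNIV) (cotangent_lift h)"
proof -
  have N: "smooth_on h N" "smooth_on (inv_into N h) (h ` N)"
    using h by (auto simp: diffeo_on_def)
  have ch: "continuous_on (N \<times> UNIV) (\<lambda>v::'a phase. h (fst v))"
    by (rule continuous_on_compose2[OF smooth_on_continuous_on[OF N(1)] continuous_on_fst])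
       (auto intro: continuous_on_id)
  have cg: "continuous_on (N \<times> UNIV) (\<lambda>v::'a phase. deriv_at (inv_into N h) (h (fst v)))"
    by (rule continuous_on_compose2[OF continuous_on_deriv_at[OF N(2)] ch]) auto
  have "continuous_on (N \<times> UNIV)
          (\<lambda>v::'a phase. (h (fst v), snd v o\<^sub>L deriv_at (inv_into N h) (h (fst v))))"
    by (intro continuous_intros ch cg)
  then show ?thesis
    by (rule continuous_on_eq) (auto simp: cotangent_lift_diffeo[OF h])
qed

text \<open>Each cotangent fibre is mapped onto the fibre over the image point. Hence the range of
  the lift is open, as needed for the domain of the conjugated map.\<close>

lemma cotangent_lift_image_Times_UNIV:
  assumes h: "diffeo_on N h"
  shows "cotangent_lift h ` (N \<times> UNIV) = h ` N \<times> UNIV"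
proof -
  have "(h u, q) \<in> cotangent_lift h ` (N \<times> UNIV)" if u: "u \<in> N" for u q
  proof (rule image_eqI)
    \<comment> \<open>The preimage of the covector \<open>q\<close> is its pullback along
      \<open>Dh(u)\<close>.\<close>
    have "(q o\<^sub>L deriv_at h u) o\<^sub>L deriv_at (inv_into N h) (h u) = q"
      by (rule blinfun_eqI) (simp add: diffeo_on_deriv_inverse[OF h u])
    then show "(h u, q) = cotangent_lift h (u, q o\<^sub>L deriv_at h u)"
      by (simp add: cotangent_lift_diffeo[OF h u])
  qed (simp add: u)
  then show ?thesis
    by (auto simp: cotangent_lift_def)
qed

section \<open>The symmetry and the open set on which it acts\<close>

lemma ordinary_symmetry_onD:
  assumes "ordinary_symmetry_on P \<Psi> D \<phi>" "v \<in> D" "v \<in> conj_domain P \<Psi> D \<phi>"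
  shows "\<phi> v \<in> P" and "\<phi> (\<Psi> v) = \<Psi> (\<phi> v)"
proof -
  \<comment> \<open>Membership in the image ensures that \<open>inv_into\<close> picks a true
    preimage in \<open>P\<close>; applying \<open>\<Psi>\<close> then turns conjugation into
    commutation.\<close>
  have "\<phi> (\<Psi> v) \<in> \<Psi> ` P" "inv_into P \<Psi> (\<phi> (\<Psi> v)) = \<phi> v"
    using assms by (auto simp: ordinary_symmetry_on_def conj_domain_def)
  then show "\<phi> v \<in> P" and "\<phi> (\<Psi> v) = \<Psi> (\<phi> v)"
    by (metis inv_into_into, metis f_inv_into_f)
qed

lemma open_vimage_cotangent_lift:
  assumes h: "diffeo_on N h" and "open X"
  shows "open {v \<in> N \<times> UNIV. cotangent_lift h v \<in> X}"
  using continuous_open_preimage[OF continuous_on_cotangent_lift[OF h] _ \<open>open X\<close>] h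
  by (auto simp: diffeo_on_def open_Times vimage_def Int_def)

lemma open_symmetry_domain:
  assumes h: "diffeo_on N h" and D: "open D" "continuous_on D \<phi>"
    and W: "open W" "smooth_on S W"
  shows "open (symmetry_domain N h W S D \<phi>)"
proof -
  have "open (cotangent_lift h ` (N \<times> UNIV))"
    using h by (simp add: cotangent_lift_image_Times_UNIV diffeo_on_def open_Times)
  then have "open (D \<inter> \<phi> -` cotangent_lift h ` (N \<times> UNIV))"
    by (intro continuous_open_preimage D)
  then have "open {v \<in> N \<times> UNIV. cotangent_lift h v \<in> D \<inter> \<phi> -` cotangent_lift h ` (N \<times> UNIV)}"
    by (rule open_vimage_cotangent_lift[OF h])
  then have "open (conj_domain (N \<times> UNIV) (cotangent_lift h) D \<phi>)"
    by (simp add: conj_domain_def del: mem_Times_iff)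
  \<comment> \<open>This map sends a pair to its initial value \<open>v\<close>; the symmetry domain
    is the preimage of the open domain of
    \<open>\<Psi>\<^sup>-\<^sup>1 \<circ> \<phi> \<circ> \<Psi>\<close> under it.\<close>
  moreover have "continuous_on W (\<lambda>p. (fst p, (\<lambda>(u, w). partial1 S u w) p))"
    by (intro continuous_intros continuous_on_partial1 W)
  ultimately have "open (W \<inter> (\<lambda>p. (fst p, (\<lambda>(u, w). partial1 S u w) p)) -`
      conj_domain (N \<times> UNIV) (cotangent_lift h) D \<phi>)"
    by (intro continuous_open_preimage W)
  also have "\<dots> = symmetry_domain N h W S D \<phi>"
    by (auto simp: symmetry_domain_def)
  finally show ?thesis .
qed

text \<open>No invariance of \<open>W\<close> under \<open>map_prod h h\<close> is assumed. Since
  \<open>\<Psi> v\<close> lies in \<open>D\<close> and \<open>W\<close> parametrizes the graph of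
  \<open>\<phi>\<close>, the base points of \<open>\<Psi> v\<close> and of
  \<open>\<phi> (\<Psi> v) = \<Psi> (\<phi> v)\<close> form a pair in \<open>W\<close>, and the
  covectors there must be the partial derivatives of \<open>S\<close>.\<close>

lemma symmetry_domain_map_prod:
  assumes h: "diffeo_on N h" and gen: "generating_function_on W S D \<phi>"
    and sym: "ordinary_symmetry_on (N \<times> UNIV) (cotangent_lift h) D \<phi>"
    and p: "(u, w) \<in> symmetry_domain N h W S D \<phi>"
  shows "u \<in> N" "w \<in> N" "(u, w) \<in> W" "(h u, h w) \<in> W"
    and "partial1 S (h u) (h w) (deriv_at h u x) = partial1 S u w x"
    and "partial2 S (h u) (h w) (deriv_at h w x) = partial2 S u w x"
proof -
  let ?\<Psi> = "cotangent_lift h" and ?v = "(u, partial1 S u w)"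
  from p show W: "(u, w) \<in> W"
    by (simp add: symmetry_domain_def)
  from p have dom: "?v \<in> conj_domain (N \<times> UNIV) ?\<Psi> D \<phi>"
    by (simp add: symmetry_domain_def)
  note v = generating_function_on_graphI[OF gen W]
  note s = ordinary_symmetry_onD[OF sym v(1) dom]
  from dom have \<Psi>v: "?\<Psi> ?v \<in> D"
    by (simp add: conj_domain_def)
  from dom show u: "u \<in> N"
    by (simp add: conj_domain_def)
  from s(1) show w: "w \<in> N"
    by (simp add: v(2))
  note g = generating_function_on_graphD[OF gen \<Psi>v]
  have fst: "fst (?\<Psi> q) = h (fst q)" for q
    by (simp add: cotangent_lift_def)
  show "(h u, h w) \<in> W"
    using g(1) by (simp add: s(2) v(2) fst)
  have "?\<Psi> ?v = (h u, partial1 S (h u) (h w))"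
    using g(2) by (simp add: s(2) v(2) fst prod_eq_iff)
  then show "partial1 S (h u) (h w) (deriv_at h u x) = partial1 S u w x"
    by (rule cotangent_lift_diffeo_pullback[OF h u])
  have "?\<Psi> (w, - partial2 S u w) = (h w, - partial2 S (h u) (h w))"
    using g(3) by (simp add: s(2) v(2) fst prod_eq_iff)
  from cotangent_lift_diffeo_pullback[OF h w this, of x]
  show "partial2 S (h u) (h w) (deriv_at h w x) = partial2 S u w x"
    by (simp add: uminus_blinfun.rep_eq)
qed

section \<open>Boundary terms and functions with zero derivative\<close>

lemma invariant_graph_deriv_at:
  assumes h: "diffeo_on N h" and "invariant_graph N h A b" and u: "u \<in> A" "u \<in> N" "h u \<in> A"
  shows "deriv_at b (h u) (deriv_at h u x) = deriv_at b u x"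
proof -
  have "cotangent_lift h (u, deriv_at b u) \<in> deriv_graph (h ` (A \<inter> N) \<inter> A) b"
    using assms unfolding invariant_graph_def deriv_graph_def by blast
  \<comment> \<open>The lifted point lies over \<open>h u\<close>, and a derivative graph has only
    one point over each base point.\<close>
  then have "cotangent_lift h (u, deriv_at b u) = (h u, deriv_at b (h u))"
    by (auto simp: deriv_graph_def cotangent_lift_def)
  then show ?thesis
    by (rule cotangent_lift_diffeo_pullback[OF h u(2)])
qed

text \<open>\<open>E\<close> may be disconnected and \<open>C\<close> need not be open, so the
  zero-derivative argument is run on the connected component of \<open>E\<close> containing
  \<open>C\<close>, which is both open and connected.\<close>

lemma constant_on_connected_subset:
  fixes f :: "'a::euclidean_space \<Rightarrow> 'b::real_normed_vector"
  assumes E: "open E" and f: "\<And>p. p \<in> E \<Longrightarrow> (f has_derivative (\<lambda>_. 0)) (at p)"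
    and C: "connected C" "C \<subseteq> E"
  obtains c where "\<And>p. p \<in> C \<Longrightarrow> f p = c"
proof (cases "C = {}")
  case False
  then obtain a where a: "a \<in> C" by auto
  let ?K = "connected_component_set E a"
  have CK: "C \<subseteq> ?K"
    using a C by (intro connected_component_maximal)
  have "f p = f a" if "p \<in> C" for p
  proof (rule has_derivative_zero_unique_connected[where f = f and s = ?K])
    show "open ?K" "connected ?K"
      by (simp_all add: E open_connected_component)
    show "(f has_derivative (\<lambda>_. 0)) (at q)" if "q \<in> ?K" for q
      using that connected_component_subset f by blast
    show "p \<in> ?K" "a \<in> ?K"
      using CK a that by auto
  qed
  then show ?thesis using that by blast
qed (use that in auto)

lemma has_derivative_diff_separated:
  assumes S: "S differentiable (at (u, w))"
    and b: "b differentiable (at u)" and b': "b' differentiable (at w)"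
  shows "((\<lambda>z. S z - (b (fst z) - b' (snd z))) has_derivative
    (\<lambda>z. (partial1 S u w - deriv_at b u) (fst z) + (partial2 S u w + deriv_at b' w) (snd z)))
    (at (u, w))"
proof -
  have "((\<lambda>z. b (fst z)) has_derivative (\<lambda>z. deriv_at b u (fst z))) (at (u, w))"
       "((\<lambda>z. b' (snd z)) has_derivative (\<lambda>z. deriv_at b' w (snd z))) (at (u, w))"
    using has_derivative_compose[of fst fst "(u, w)" UNIV b "deriv_at b u"]
          has_derivative_compose[of snd snd "(u, w)" UNIV b' "deriv_at b' w"]
    by (simp_all add: has_derivative_deriv_at b b'
        bounded_linear_imp_has_derivative bounded_linear_fst bounded_linear_snd)
  then show ?thesis
    using has_derivative_partials(1)[OF S]
    by (auto intro!: derivative_eq_intros simp: blinfun.diff_left blinfun.add_left)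
qed

section \<open>The boundary value problem as a critical point problem\<close>

theorem corollary3p4:
  fixes N :: "'a::euclidean_space set"
    and h :: "'a \<Rightarrow> 'a"
    and D :: "'m \<Rightarrow> 'a phase set"
    and \<phi> :: "'m \<Rightarrow> 'a phase \<Rightarrow> 'a phase"
    and W :: "'m \<Rightarrow> ('a \<times> 'a) set"
    and S :: "'m \<Rightarrow> 'a \<times> 'a \<Rightarrow> real"
    and A A' :: "'m \<Rightarrow> 'a set"
    and b b' :: "'m \<Rightarrow> 'a \<Rightarrow> real"
    and B S' :: "'m \<Rightarrow> 'a \<times> 'a \<Rightarrow> real"
  assumes h: "diffeo_on N h"
    and phi: "\<And>\<mu>. symplectic_on (D \<mu>) (\<phi> \<mu>)"
    and gen: "\<And>\<mu>. generating_function_on (W \<mu>) (S \<mu>) (D \<mu>) (\<phi> \<mu>)"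
    and sym: "\<And>\<mu>. ordinary_symmetry_on (N \<times> UNIV) (cotangent_lift h) (D \<mu>) (\<phi> \<mu>)"
    and b: "\<And>\<mu>. open (A \<mu>) \<and> smooth_on (b \<mu>) (A \<mu>)"
    and b': "\<And>\<mu>. open (A' \<mu>) \<and> smooth_on (b' \<mu>) (A' \<mu>)"
    and dom: "\<And>\<mu>. W \<mu> \<subseteq> A \<mu> \<times> A' \<mu>"
    and inv: "\<And>\<mu>. invariant_graph N h (A \<mu>) (b \<mu>)"
    and inv': "\<And>\<mu>. invariant_graph N h (A' \<mu>) (b' \<mu>)"
    and B_def: "\<And>\<mu> u w. B \<mu> (u, w) = b \<mu> u - b' \<mu> w"
    and S'_def: "\<And>\<mu> p. S' \<mu> p = S \<mu> p - B \<mu> p"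
  shows "\<forall>\<mu>.
    bij_betw (\<lambda>v. (fst v, fst (\<phi> \<mu> v)))
      (bvp_solutions (D \<mu>) (\<phi> \<mu>) (deriv_graph (A \<mu>) (b \<mu>)) (deriv_graph (A' \<mu>) (b' \<mu>)))
      (critical_points (W \<mu>) (S' \<mu>)) \<and>
    (let E = symmetry_domain N h (W \<mu>) (S \<mu>) (D \<mu>) (\<phi> \<mu>) in
      open E \<and> map_prod h h ` E \<subseteq> W \<mu> \<and>
      (\<forall>C. connected C \<and> C \<subseteq> E \<longrightarrow>
         (\<exists>c. \<forall>p\<in>C. (S' \<mu> \<circ> map_prod h h) p = S' \<mu> p + c)))"
proof (intro allI)
  fix \<mu>
  define F where "F = S' \<mu>"
  let ?D = "D \<mu>" and ?\<phi> = "\<phi> \<mu>" and ?W = "W \<mu>" and ?S = "S \<mu>"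
  let ?sols = "bvp_solutions ?D ?\<phi> (deriv_graph (A \<mu>) (b \<mu>)) (deriv_graph (A' \<mu>) (b' \<mu>))"
  let ?E = "symmetry_domain N h ?W ?S ?D ?\<phi>"
  have F: "F = (\<lambda>z. ?S z - (b \<mu> (fst z) - b' \<mu> (snd z)))"
    unfolding F_def by (rule ext) (metis S'_def B_def prod.collapse)
  have W: "open ?W" "smooth_on ?S ?W"
    using gen by (auto simp: generating_function_on_def)
  have AA': "u \<in> A \<mu>" "w \<in> A' \<mu>" if "(u, w) \<in> ?W" for u w
    using that dom by auto
  have dF: "(F has_derivative (\<lambda>z. (partial1 ?S u w - deriv_at (b \<mu>) u) (fst z) +
      (partial2 ?S u w + deriv_at (b' \<mu>) w) (snd z))) (at (u, w))" if "(u, w) \<in> ?W" for u w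
    unfolding F using that AA'[OF that] b b' W
    by (intro has_derivative_diff_separated) (auto intro: smooth_on_differentiable)
  \<comment> \<open>By uniqueness of the derivative, criticality means that both covectors in
    \<open>dF\<close> vanish. The signs match: these are the two boundary conditions for
    \<open>(u, D\<^sub>u S)\<close> and its image \<open>(w, - D\<^sub>w S)\<close>.\<close>
  have crit: "(u, w) \<in> critical_points ?W F \<longleftrightarrow> (u, w) \<in> ?W \<and>
      partial1 ?S u w = deriv_at (b \<mu>) u \<and> - partial2 ?S u w = deriv_at (b' \<mu>) w" for u w
  proof (cases "(u, w) \<in> ?W")
    case True
    let ?p = "partial1 ?S u w - deriv_at (b \<mu>) u" and ?q = "partial2 ?S u w + deriv_at (b' \<mu>) w"
    have "GDERIV F (u, w) :> 0 \<longleftrightarrow> (\<lambda>z. ?p (fst z) + ?q (snd z)) = (\<lambda>z. 0)"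
      using dF[OF True] has_derivative_unique by (auto simp: gderiv_def)
    also have "\<dots> \<longleftrightarrow> ?p = 0 \<and> ?q = 0"
    proof
      assume eq: "(\<lambda>z. ?p (fst z) + ?q (snd z)) = (\<lambda>z. 0)"
      have "?p x = 0" "?q x = 0" for x
        using fun_cong[OF eq, of "(x, 0)"] fun_cong[OF eq, of "(0, x)"] by auto
      then show "?p = 0 \<and> ?q = 0" by (intro conjI blinfun_eqI) (simp_all only: blinfun.zero_left)
    qed simp
    finally show ?thesis
      using True by (simp add: critical_points_def neg_eq_iff_add_eq_0)
  qed (simp add: critical_points_def)

  have "bij_betw (\<lambda>v. (fst v, fst (?\<phi> v))) ?sols (critical_points ?W F)"
  \<comment> \<open>The inverse recovers the initial covector from the endpoints through the
    generating function.\<close>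
  proof (rule bij_betw_byWitness[where f' = "\<lambda>(u, w). (u, partial1 ?S u w)"])
    note g = generating_function_on_graphD[OF gen[of \<mu>]]
    show "\<forall>v\<in>?sols. (\<lambda>(u, w). (u, partial1 ?S u w)) (fst v, fst (?\<phi> v)) = v"
      using g(2) by (simp add: bvp_solutions_def prod_eq_iff)
    show "(\<lambda>v. (fst v, fst (?\<phi> v))) ` ?sols \<subseteq> critical_points ?W F"
    proof (rule image_subsetI)
      fix v assume "v \<in> ?sols"
      then have "v \<in> ?D" "snd v = deriv_at (b \<mu>) (fst v)"
        "snd (?\<phi> v) = deriv_at (b' \<mu>) (fst (?\<phi> v))"
        by (simp_all add: bvp_solutions_def mem_deriv_graph_iff)
      then show "(fst v, fst (?\<phi> v)) \<in> critical_points ?W F"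
        using g[of v] by (simp add: crit)
    qed
    note v = generating_function_on_graphI[OF gen[of \<mu>]]
    show "\<forall>p\<in>critical_points ?W F. (\<lambda>v. (fst v, fst (?\<phi> v))) ((\<lambda>(u, w). (u, partial1 ?S u w)) p) = p"
      using v(2) by (auto simp: critical_points_def)
    have "(u, partial1 ?S u w) \<in> ?sols" if "(u, w) \<in> critical_points ?W F" for u w
    proof -
      from that have uw: "(u, w) \<in> ?W" "partial1 ?S u w = deriv_at (b \<mu>) u"
        "- partial2 ?S u w = deriv_at (b' \<mu>) w"
        by (simp_all add: crit)
      then have "(u, partial1 ?S u w) \<in> deriv_graph (A \<mu>) (b \<mu>)"
        "(w, - partial2 ?S u w) \<in> deriv_graph (A' \<mu>) (b' \<mu>)"
        using AA' by (auto simp: mem_deriv_graph_iff)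
      then show ?thesis
        using v[OF uw(1)] by (simp add: bvp_solutions_def)
    qed
    then show "(\<lambda>(u, w). (u, partial1 ?S u w)) ` critical_points ?W F \<subseteq> ?sols"
      by auto
  qed
  moreover have E: "open ?E"
    using phi[of \<mu>] W smooth_on_continuous_on
    by (intro open_symmetry_domain h) (auto simp: symplectic_on_def)
  moreover note sd = symmetry_domain_map_prod[OF h gen[of \<mu>] sym[of \<mu>]]
  have "map_prod h h ` ?E \<subseteq> ?W"
    using sd(4) by auto
  moreover have "\<exists>c. \<forall>p\<in>C. (F \<circ> map_prod h h) p = F p + c" if C: "connected C" "C \<subseteq> ?E" for C
  proof -
    \<comment> \<open>The chain rule evaluates \<open>dF\<close> at \<open>(h u, h w)\<close> on
      \<open>(Dh(u) x, Dh(w) y)\<close>. The pullback identities for \<open>S\<close>,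
      \<open>b\<close> and \<open>b'\<close> make this equal to \<open>dF\<close> at
      \<open>(u, w)\<close> on \<open>(x, y)\<close>.\<close>
    have "((\<lambda>p. F (map_prod h h p) - F p) has_derivative (\<lambda>_. 0)) (at p)" if "p \<in> ?E" for p
    proof -
      obtain u w where p: "p = (u, w)" by fastforce
      note m = sd[OF that[unfolded p]]
      have dh: "(h has_derivative deriv_at h x) (at x)" if "x \<in> N" for x
        using that h has_derivative_deriv_at smooth_on_differentiable unfolding diffeo_on_def by blast
      have "(map_prod h h has_derivative (\<lambda>z. (deriv_at h u (fst z), deriv_at h w (snd z)))) (at (u, w))"
        unfolding map_prod_def case_prod_unfold
        using has_derivative_compose[of fst fst "(u, w)" UNIV h "deriv_at h u"]
          has_derivative_compose[of snd snd "(u, w)" UNIV h "deriv_at h w"]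
        by (intro has_derivative_Pair) (simp_all add: dh m
        bounded_linear_imp_has_derivative bounded_linear_fst bounded_linear_snd)
      from has_derivative_compose[OF this, unfolded map_prod_simp, OF dF[OF m(4)]] dF[OF m(3)]
      show ?thesis
        unfolding p
        by (rule has_derivative_eq_rhs[OF has_derivative_diff])
           (auto simp: blinfun.diff_left blinfun.add_left m
             invariant_graph_deriv_at[OF h inv] invariant_graph_deriv_at[OF h inv'] AA'[OF m(3)] AA'[OF m(4)])
    qed
    from constant_on_connected_subset[OF E this C]
    obtain c where "\<And>p. p \<in> C \<Longrightarrow> F (map_prod h h p) - F p = c" by blast
    then show ?thesis
      by (intro exI[of _ c]) (auto simp: algebra_simps)
  qed
  ultimately show "bij_betw (\<lambda>v. (fst v, fst (?\<phi> v))) ?sols (critical_points ?W (S' \<mu>)) \<and>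
    (let E = ?E in open E \<and> map_prod h h ` E \<subseteq> ?W \<and>
      (\<forall>C. connected C \<and> C \<subseteq> E \<longrightarrow>
         (\<exists>c. \<forall>p\<in>C. (S' \<mu> \<circ> map_prod h h) p = S' \<mu> p + c)))"
    unfolding F_def Let_def by blast
qed

end
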